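(* Let $\mu$ be a non-trivial weakly stable probability measure on $\mathbb{R}$ with $\varkappa=\varkappa(\mu)>0$, and let $\{\widetilde{X}_n : n\in\mathbb{N}_0\}$ be the random walk under the weak generalized convolution $\otimes_\mu$ with $\widetilde X_0=0$ and i.i.d. increments $(\Delta\widetilde{X}_i)_{i\in\mathbb{N}}$ with distribution $\nu$ (a probability measure on $\mathbb{R}$). Let $Y,Y_1,Y_2,\dots$ be an i.i.d. sequence of random variables with distribution $\mu$, independent of $(\Delta\widetilde{X}_i)_{i\in\mathbb{N}}$, and let $\widetilde S_n=\sum_{k=1}^n \Delta\widetilde X_k\cdot Y_k$. Suppose there exist sequences of positive numbers $(a_n)_{n\in\mathbb{N}}$ and $(b_n)_{n\in\mathbb{N}}$ such that $a_n\nearrow\varkappa$, $b_n\to\infty$ and $$\limsup_{n\to\infty} b_n^{-1}\,\mathbb{E}\bigl(|\widetilde S_n|^{a_n}\bigr)=c\in(0,\infty).$$ Then for every sequence of positive numbers $(c_n)_{n\in\mathbb{N}}$ with $\sum_{n=1}^\infty c_n^{-1}<\infty$ we have $$\mathbf{P}\left(\bigcup_{n=1}^\infty\bigcap_{k=n}^\infty\left\{|\widetilde X_k|\le\left(\frac{c_kb_k}{d_k}\right)^{1/a_k}\right\}\right)=1,$$ where $d_n=\mathbb{E}|Y|^{a_n}$.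
   Context: Let $\mathcal{P}$ be the set of Borel probability measures on $\mathbb{R}$. For $a\in\mathbb{R}$, $T_a\lambda$ is the law of $a\theta$ when $\theta\sim\lambda$. For $\mu,\lambda\in\mathcal P$, $\mu\circ\lambda$ is the law of the product $Y\theta$ of independent $Y\sim\mu$, $\theta\sim\lambda$; $*$ is ordinary convolution. A measure $\mu\in\mathcal{P}$ is weakly stable if for all $a,b\in\mathbb{R}$ there is $\lambda\in\mathcal{P}$ with $T_a\mu*T_b\mu=\mu\circ\lambda$; equivalently, for all $\lambda_1,\lambda_2\in\mathcal{P}$ there is $\lambda\in\mathcal{P}$ with $(\mu\circ\lambda_1)*(\mu\circ\lambda_2)=\mu\circ\lambda$. It is non-trivial if it has no atoms. The weak generalized convolution $\lambda_1\otimes_\mu\lambda_2$ is this $\lambda$ (unique) if $\mu$ is not symmetric, and the symmetrization $\widetilde\lambda$ of this $\lambda$ (unique) if $\mu$ is symmetric, where $\widetilde\lambda=\frac12|\lambda|+\frac12T_{-1}|\lambda|$ and $|\lambda|$ is the law of $|\theta|$ for $\theta\sim\lambda$. Powers $\nu^{\otimes_\mu n}$ are taken with respect to $\otimes_\mu$. The random walk under $\otimes_\mu$ with step distribution $\nu$ is the Markov process with $\widetilde X_0=0$ and transition probabilities $P(\widetilde X_n\in A\mid\widetilde X_k=x)=\bigl(\delta_x\otimes_\mu\nu^{\otimes_\mu(n-k)}\bigr)(A)$ for $k<n$, $x\in\mathbb{R}$, $A$ Borel; thus $\mathcal{L}(\widetilde X_n)=\mathcal{L}(\Delta\widetilde X_1)\otimes_\mu\cdots\otimes_\mu\mathcal{L}(\Delta\widetilde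 X_n)$, and consequently $\widetilde S_n$ has the same law as the product $\widetilde X_nY$ with $\widetilde X_n$ and $Y$ taken independent. The characterizing exponent is $\varkappa(\mu)=\sup\{p\in[0,2]:\int_{\mathbb{R}}|x|^p\,\mu(dx)<\infty\}$. The notation $a_n\nearrow\varkappa$ means that $(a_n)$ is non-decreasing and converges to $\varkappa$. *)

theory Defs
  imports "HOL-Probability.Probability"
begin

definition rescale :: "real \<Rightarrow> real measure \<Rightarrow> real measure" where
  "rescale a L = distr L borel (\<lambda>x. a * x)"

text \<open>Law of \<open>Y * \<theta>\<close> for independent \<open>Y\<close> with law \<open>\<mu>\<close> and \<open>\<theta>\<close> with law \<open>L\<close>.\<close>

definition mixture :: "real measure \<Rightarrow> real measure \<Rightarrow> real measure" where
  "mixture \<mu> L = distr (\<mu> \<Otimes>\<^sub>M L) borel (\<lambda>(y, t). y * t)"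

definition weakly_stable :: "real measure \<Rightarrow> bool" where
  "weakly_stable \<mu> \<longleftrightarrow> real_distribution \<mu> \<and>
     (\<forall>a b. \<exists>L. real_distribution L \<and> (rescale a \<mu> \<star> rescale b \<mu>) = mixture \<mu> L)"

definition nontrivial_measure :: "real measure \<Rightarrow> bool" where
  "nontrivial_measure \<mu> \<longleftrightarrow> (\<forall>x. measure \<mu> {x} = 0)"

definition symmetric_measure :: "real measure \<Rightarrow> bool" where
  "symmetric_measure \<mu> \<longleftrightarrow> rescale (-1) \<mu> = \<mu>"

definition abs_law :: "real measure \<Rightarrow> real measure" where
  "abs_law L = distr L borel (\<lambda>x. \<bar>x\<bar>)"

definition symmetrization :: "real measure \<Rightarrow> real measure" where
  "symmetrization L = measure_of UNIV (sets borel)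
     (\<lambda>A. (1/2) * emeasure (abs_law L) A + (1/2) * emeasure (rescale (-1) (abs_law L)) A)"

lemma sets_symmetrization [simp]: "sets (symmetrization L) = sets borel"
  unfolding symmetrization_def using sets.sigma_sets_eq[of borel] by simp

lemma space_symmetrization [simp]: "space (symmetrization L) = UNIV"
  unfolding symmetrization_def by simp

text \<open>The set function in the definition of \<open>symmetrization\<close> is countably additive, so
  \<open>measure_of\<close> does not alter it.\<close>

lemma emeasure_symmetrization:
  assumes "A \<in> sets borel"
  shows "emeasure (symmetrization L) A =
    (1/2) * emeasure (abs_law L) A + (1/2) * emeasure (rescale (-1) (abs_law L)) A"
proof (rule emeasure_measure_of[OF symmetrization_def])
  show "countably_additive (sets (symmetrization L))
    (\<lambda>A. (1/2) * emeasure (abs_law L) A + (1/2) * emeasure (rescale (-1) (abs_law L)) A)"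
  proof (rule countably_additiveI)
    fix F :: "nat \<Rightarrow> real set"
    assume F: "range F \<subseteq> sets (symmetrization L)" "disjoint_family F"
    have 1: "(\<Sum>i. emeasure (abs_law L) (F i)) = emeasure (abs_law L) (\<Union>i. F i)"
      using F by (intro suminf_emeasure) (auto simp: abs_law_def)
    have 2: "(\<Sum>i. emeasure (rescale (-1) (abs_law L)) (F i))
        = emeasure (rescale (-1) (abs_law L)) (\<Union>i. F i)"
      using F by (intro suminf_emeasure) (auto simp: rescale_def)
    show "(\<Sum>i. (1/2) * emeasure (abs_law L) (F i)
          + (1/2) * emeasure (rescale (-1) (abs_law L)) (F i))
        = (1/2) * emeasure (abs_law L) (\<Union>i. F i)
          + (1/2) * emeasure (rescale (-1) (abs_law L)) (\<Union>i. F i)"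
      unfolding 1[symmetric] 2[symmetric]
      by (simp add: suminf_add[symmetric] del: ennreal_suminf_cmult)
         (simp add: ennreal_suminf_cmult[symmetric] del: ennreal_suminf_cmult)
  qed
qed (use assms in \<open>auto simp: positive_def\<close>)

text \<open>For non-trivial weakly stable \<open>\<mu>\<close>, the chosen law exists. It is unique if \<open>\<mu>\<close> is not
  symmetric, and its symmetrization is unique if \<open>\<mu>\<close> is symmetric, so the result does not
  depend on the choice.\<close>

definition weak_conv :: "real measure \<Rightarrow> real measure \<Rightarrow> real measure \<Rightarrow> real measure" where
  "weak_conv \<mu> L1 L2 =
     (let L = (SOME L. real_distribution L \<and> (mixture \<mu> L1 \<star> mixture \<mu> L2) = mixture \<mu> L)
      in if symmetric_measure \<mu> then symmetrization L else L)"

text \<open>The first power is \<open>\<nu>\<close> itself and not \<open>weak_conv \<mu> (return borel 0) \<nu>\<close>, which is the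
  symmetrization of \<open>\<nu>\<close> when \<open>\<mu>\<close> is symmetric.\<close>

fun weak_conv_power :: "real measure \<Rightarrow> real measure \<Rightarrow> nat \<Rightarrow> real measure" where
  "weak_conv_power \<mu> \<nu> 0 = return borel 0"
| "weak_conv_power \<mu> \<nu> (Suc 0) = \<nu>"
| "weak_conv_power \<mu> \<nu> (Suc (Suc n)) = weak_conv \<mu> (weak_conv_power \<mu> \<nu> (Suc n)) \<nu>"

text \<open>The sigma-algebra generated by \<open>X 0, \<dots>, X k\<close>.\<close>

definition past :: "'w measure \<Rightarrow> (nat \<Rightarrow> 'w \<Rightarrow> real) \<Rightarrow> nat \<Rightarrow> 'w measure" where
  "past M X k = sigma (space M) {X i -` A \<inter> space M | i A. i \<le> k \<and> A \<in> sets borel}"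

text \<open>The conditional probability of \<open>X n \<in> A\<close> given \<open>X 0, \<dots>, X k\<close> depends on \<open>X k\<close> only
  (Markov property) and is given by the transition kernel.\<close>

definition weak_random_walk ::
    "'w measure \<Rightarrow> real measure \<Rightarrow> real measure \<Rightarrow> (nat \<Rightarrow> 'w \<Rightarrow> real) \<Rightarrow> bool" where
  "weak_random_walk M \<mu> \<nu> X \<longleftrightarrow>
     (\<forall>n. X n \<in> borel_measurable M) \<and>
     (AE \<omega> in M. X 0 \<omega> = 0) \<and>
     (\<forall>k n. \<forall>A\<in>sets borel. k < n \<longrightarrow>
        (AE \<omega> in M. real_cond_exp M (past M X k) (\<lambda>\<omega>. indicator A (X n \<omega>)) \<omega> =
           measure (weak_conv \<mu> (return borel (X k \<omega>)) (weak_conv_power \<mu> \<nu> (n - k))) A))"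

definition abs_moment :: "real measure \<Rightarrow> real \<Rightarrow> ennreal" where
  "abs_moment L p = (\<integral>\<^sup>+x. ennreal (\<bar>x\<bar> powr p) \<partial>L)"

definition char_exponent :: "real measure \<Rightarrow> real" where
  "char_exponent \<mu> = Sup {p. 0 \<le> p \<and> p \<le> 2 \<and> abs_moment \<mu> p < \<infinity>}"

end

theory Submission
  imports Defs
begin

text \<open>The randomized sum has the law of a product: \<open>S n\<close> is distributed as \<open>X n * Y\<close> with \<open>Y\<close> of law
  \<open>\<mu>\<close> independent of \<open>X n\<close> (established inside the proof of the theorem). Therefore the moments
  factor (\<open>abs_moment_mixture\<close>), and \<open>E \<bar>S n\<bar> powr a n = d n * E \<bar>X n\<bar> powr a n\<close>. The hypothesis on
  the limit superior bounds the left side by \<open>(C + 1) * b n\<close> for large \<open>n\<close>, Markov's inequality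
  bounds the probability that \<open>\<bar>X n\<bar> powr a n\<close> exceeds \<open>c n * b n / d n\<close> by \<open>(C + 1) / c n\<close>
  (\<open>moment_tail_bound\<close>), and Borel-Cantelli finishes (\<open>AE_eventually_bounded_of_moments\<close>). The
  moment \<open>d n\<close> may be infinite when \<open>a n\<close> equals the characterizing exponent; then the factorization
  forces \<open>X n = 0\<close> almost surely and the bound, read as \<open>0\<close>, still holds. It is never \<open>0\<close>, because
  \<open>\<mu>\<close> has no atom at the origin.

  The law of \<open>S n\<close> is the \<open>n\<close>-fold convolution of \<open>mixture \<mu> \<nu>\<close>, since the products \<open>DX k * Y k\<close> are
  independent with this law. The law of \<open>X n\<close> is given by the transition probabilities from time
  \<open>0\<close> (\<open>weak_random_walk_law\<close>), and mixing \<open>\<mu>\<close> over it yields the same convolution, provided that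
  \<open>mixture \<mu> (weak_conv \<mu> L1 L2)\<close> is the convolution of \<open>mixture \<mu> L1\<close> and \<open>mixture \<mu> L2\<close>
  (\<open>weak_conv_mixture\<close>). This identity requires that convolutions of mixtures of \<open>\<mu>\<close> are again
  mixtures of \<open>\<mu>\<close>, whereas weak stability asserts it only for deterministic scales. The passage
  to random scales, \<open>weakly_stable_convolution_of_mixtures\<close>, is the main step: the scales are
  discretised, and the resulting mixing laws converge along a subsequence because tightness of
  mixtures implies tightness of the mixing laws (\<open>tight_if_mixtures_converge\<close>).\<close>

section \<open>Characteristic functions of mixtures and convolutions\<close>

lemma real_distribution_mixture:
  assumes "real_distribution \<mu>" "real_distribution L"
  shows "real_distribution (mixture \<mu> L)"
proof -
  interpret m: real_distribution \<mu> by fact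
  interpret l: real_distribution L by fact
  interpret pair_prob_space \<mu> L ..
  show ?thesis unfolding mixture_def by (intro real_distribution_distr) simp
qed

lemma real_distribution_convolution:
  assumes "real_distribution K" "real_distribution L"
  shows "real_distribution (K \<star> L)"
proof -
  interpret m: real_distribution K by fact
  interpret l: real_distribution L by fact
  interpret pair_prob_space K L ..
  show ?thesis unfolding convolution_def by (intro real_distribution_distr) simp
qed

lemma real_distribution_return: "real_distribution (return borel x)"
  by (simp add: real_distribution_def real_distribution_axioms_def prob_space_return)

lemma char_convolution:
  assumes "real_distribution K" "real_distribution L"
  shows "char (K \<star> L) t = char K t * char L t"
proof -
  interpret m: real_distribution K by fact
  interpret l: real_distribution L by fact
  interpret pair_prob_space K L ..
  have "char (K \<star> L) t = (\<integral>z. iexp (t * (fst z + snd z)) \<partial>(K \<Otimes>\<^sub>M L))"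
    by (simp add: char_def convolution_def integral_distr case_prod_beta')
  also have "\<dots> = (\<integral>x. \<integral>y. iexp (t * (x + y)) \<partial>L \<partial>K)"
    by (subst integral_fst'[symmetric]) (auto intro!: P.integrable_iexp)
  also have "\<dots> = (\<integral>x. \<integral>y. iexp (t * x) * iexp (t * y) \<partial>L \<partial>K)"
    by (simp add: algebra_simps exp_add)
  also have "\<dots> = char K t * char L t"
    by (simp add: char_def)
  finally show ?thesis .
qed

text \<open>Conditioning on the mixing variable. The right-hand side is the integral of a fixed bounded
  continuous function of \<open>x\<close>, so weak limits in \<open>L\<close> pass to the mixture.\<close>

lemma char_mixture:
  assumes "real_distribution \<mu>" "real_distribution L"
  shows "char (mixture \<mu> L) t = (\<integral>x. char \<mu> (t * x) \<partial>L)"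
proof -
  interpret m: real_distribution \<mu> by fact
  interpret l: real_distribution L by fact
  interpret pair_prob_space \<mu> L ..
  have "char (mixture \<mu> L) t = (\<integral>z. iexp (t * (fst z * snd z)) \<partial>(\<mu> \<Otimes>\<^sub>M L))"
    by (simp add: char_def mixture_def integral_distr case_prod_beta')
  also have "\<dots> = (\<integral>x. \<integral>y. iexp (t * (y * x)) \<partial>\<mu> \<partial>L)"
    using integral_snd[of "\<lambda>y x. iexp (t * (y * x))"]
    by (simp add: case_prod_beta' P.integrable_iexp del: of_real_mult)
  also have "\<dots> = (\<integral>x. char \<mu> (t * x) \<partial>L)"
    by (simp add: char_def algebra_simps)
  finally show ?thesis .
qed

lemma char_rescale:
  assumes "real_distribution \<mu>"
  shows "char (rescale a \<mu>) t = char \<mu> (t * a)"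
proof -
  interpret m: real_distribution \<mu> by fact
  show ?thesis
    by (simp add: char_def rescale_def integral_distr algebra_simps)
qed

lemma real_distribution_rescale:
  assumes "real_distribution \<mu>"
  shows "real_distribution (rescale a \<mu>)"
proof -
  interpret m: real_distribution \<mu> by fact
  show ?thesis unfolding rescale_def by (intro m.real_distribution_distr) simp
qed

section \<open>Tightness of the mixing laws\<close>

text \<open>Tightness demands one window for all indices, while weak convergence controls only late
  ones. The finitely many early laws are each tight, so enlarging the window absorbs them.\<close>

lemma tight_of_tails:
  assumes rd: "\<And>n. real_distribution (L n)"
    and tails: "\<And>e. 0 < e \<Longrightarrow> \<exists>R. \<forall>\<^sub>F n in sequentially. measure (L n) {x. R < \<bar>x\<bar>} < e"
  shows "tight L"
  unfolding tight_def
proof (intro conjI allI impI)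
  fix e :: real assume e: "0 < e"
  interpret L: real_distribution "L n" for n by (rule rd)
  obtain R0 N where R0: "\<And>n. n \<ge> N \<Longrightarrow> measure (L n) {x. R0 < \<bar>x\<bar>} < e"
    using tails[OF e] by (auto simp: eventually_sequentially)
  have "\<exists>R. measure (L n) {x. R < \<bar>x\<bar>} < e" for n
  proof -
    have "(\<lambda>k. measure (L n) {x. real k < \<bar>x\<bar>}) \<longlonglongrightarrow> measure (L n) (\<Inter>k. {x. real k < \<bar>x\<bar>})"
      by (intro L.finite_Lim_measure_decseq) (auto simp: decseq_def)
    moreover have "(\<Inter>k. {x. real k < \<bar>x\<bar>}) = ({} :: real set)"
    proof -
      have "\<exists>k. \<not> real k < \<bar>x\<bar>" for x :: real
        using reals_Archimedean2[of "\<bar>x\<bar>"] less_asym by blast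
      then show ?thesis by auto
    qed
    ultimately have "(\<lambda>k. measure (L n) {x. real k < \<bar>x\<bar>}) \<longlonglongrightarrow> 0"
      by simp
    from order_tendstoD(2)[OF this e] show ?thesis
      by (auto simp: eventually_sequentially)
  qed
  then obtain r where r: "\<And>n. measure (L n) {x. r n < \<bar>x\<bar>} < e"
    by metis
  define R where "R = Max (insert 1 (insert R0 (r ` {..<N})))"
  have R1: "1 \<le> R" "R0 \<le> R" "\<And>n. n < N \<Longrightarrow> r n \<le> R"
    unfolding R_def by (auto intro!: Max_ge simp del: Max_insert)
  have tail: "measure (L n) {x. R < \<bar>x\<bar>} < e" for n
  proof (cases "n < N")
    case True
    have "measure (L n) {x. R < \<bar>x\<bar>} \<le> measure (L n) {x. r n < \<bar>x\<bar>}"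
      using R1(3)[OF True] by (intro L.finite_measure_mono) auto
    then show ?thesis using r[of n] by simp
  next
    case False
    have "measure (L n) {x. R < \<bar>x\<bar>} \<le> measure (L n) {x. R0 < \<bar>x\<bar>}"
      using R1(2) by (intro L.finite_measure_mono) auto
    then show ?thesis using R0[of n] False by simp
  qed
  show "\<exists>a b. a < b \<and> (\<forall>n. measure (L n) {a<..b} > 1 - e)"
  proof (intro exI conjI allI)
    show "- (R + 1) < R" using R1 by simp
    fix n
    have "1 - measure (L n) {x. R < \<bar>x\<bar>} = measure (L n) (UNIV - {x. R < \<bar>x\<bar>})"
      using L.prob_compl[of "{x. R < \<bar>x\<bar>}" n] by simp
    also have "\<dots> \<le> measure (L n) {- (R + 1)<..R}"
      by (intro L.finite_measure_mono) auto
    finally show "1 - e < measure (L n) {- (R + 1)<..R}"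
      using tail[of n] by simp
  qed
qed (rule rd)

text \<open>The indicator of a tail lies below the bounded continuous function
  \<open>min 1 (\<bar>x\<bar> / R)\<close>, whose integrals converge. Its integral against the limit law is small for
  large \<open>R\<close> by dominated convergence.\<close>

lemma weak_conv_m_tails:
  assumes rd: "\<And>n. real_distribution (K n)" "real_distribution K'"
    and conv: "weak_conv_m K K'" and e: "0 < e"
  shows "\<exists>R>0. \<forall>\<^sub>F n in sequentially. measure (K n) {x. R < \<bar>x\<bar>} < e"
proof -
  interpret K: real_distribution "K n" for n by (rule rd)
  interpret K': real_distribution K' by (rule rd)
  define g where "g = (\<lambda>R x. min 1 (\<bar>x\<bar> / R) :: real)"
  have [measurable]: "g R \<in> borel_measurable borel" for R
    unfolding g_def by simp
  have gb: "0 \<le> g R x" "g R x \<le> 1" if "0 < R" for R x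
    using that by (auto simp: g_def)
  have "(\<lambda>k. \<integral>x. g (real (Suc k)) x \<partial>K') \<longlonglongrightarrow> (\<integral>x. 0 \<partial>K')"
  proof (rule integral_dominated_convergence[where w = "\<lambda>_. 1"])
    show "AE x in K'. (\<lambda>k. g (real (Suc k)) x) \<longlonglongrightarrow> 0"
    proof (rule AE_I2)
      fix x
      have "(\<lambda>k. min 1 (\<bar>x\<bar> * inverse (real (Suc k)))) \<longlonglongrightarrow> min 1 (\<bar>x\<bar> * 0)"
        by (intro tendsto_intros LIMSEQ_inverse_real_of_nat)
      then show "(\<lambda>k. g (real (Suc k)) x) \<longlonglongrightarrow> 0"
        by (simp add: g_def divide_inverse)
    qed
    show "AE x in K'. norm (g (real (Suc k)) x) \<le> 1" for k
      by (auto simp: g_def)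
  qed auto
  then have "\<forall>\<^sub>F k in sequentially. (\<integral>x. g (real (Suc k)) x \<partial>K') < e"
    using e by (intro order_tendstoD(2)[of _ 0]) auto
  then obtain k where k: "(\<integral>x. g (real (Suc k)) x \<partial>K') < e"
    by (auto simp: eventually_sequentially)
  define R where "R = real (Suc k)"
  have R: "0 < R" by (simp add: R_def)
  have "(\<lambda>n. \<integral>x. g R x \<partial>K n) \<longlonglongrightarrow> (\<integral>x. g R x \<partial>K')"
  proof (rule weak_conv_imp_integral_bdd_continuous_conv[where B = 1])
    show "isCont (g R) x" for x
      unfolding g_def using R by (intro continuous_intros) auto
    show "norm (g R x) \<le> 1" for x
      using gb[OF R, of x] by simp
  qed (use rd conv in auto)
  then have "\<forall>\<^sub>F n in sequentially. (\<integral>x. g R x \<partial>K n) < e"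
    using k unfolding R_def by (intro order_tendstoD(2))
  then have "\<forall>\<^sub>F n in sequentially. measure (K n) {x. R < \<bar>x\<bar>} < e"
  proof eventually_elim
    case (elim n)
    have "measure (K n) {x. R < \<bar>x\<bar>} = (\<integral>x. indicator {x. R < \<bar>x\<bar>} x \<partial>K n)"
      by simp
    also have "\<dots> \<le> (\<integral>x. g R x \<partial>K n)"
    proof (rule integral_mono)
      show "integrable (K n) (g R)"
        using gb[OF R] by (intro K.integrable_const_bound[where B = 1]) auto
      show "indicator {x. R < \<bar>x\<bar>} x \<le> g R x" for x
        using R gb[OF R, of x] by (auto simp: g_def indicator_def)
    qed (auto simp: K.emeasure_eq_measure)
    finally show ?case using elim by simp
  qed
  with R show ?thesis by blast
qed

text \<open>If \<open>Y\<close> exceeds \<open>\<delta>\<close> and \<open>\<theta>\<close> exceeds \<open>R / \<delta>\<close> in absolute value, then \<open>Y * \<theta>\<close> exceeds \<open>R\<close>: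
  the tails of a mixture control those of the mixing law.\<close>

lemma measure_mixture_tail:
  assumes "real_distribution \<mu>" "real_distribution L" and pos: "0 < R" "0 < \<delta>"
  shows "measure \<mu> {y. \<delta> < \<bar>y\<bar>} * measure L {x. R / \<delta> < \<bar>x\<bar>} \<le> measure (mixture \<mu> L) {z. R < \<bar>z\<bar>}"
proof -
  interpret m: real_distribution \<mu> by fact
  interpret l: real_distribution L by fact
  interpret pair_prob_space \<mu> L ..
  have "measure \<mu> {y. \<delta> < \<bar>y\<bar>} * measure L {x. R / \<delta> < \<bar>x\<bar>}
      = measure (\<mu> \<Otimes>\<^sub>M L) ({y. \<delta> < \<bar>y\<bar>} \<times> {x. R / \<delta> < \<bar>x\<bar>})"
    by (simp add: measure_def l.emeasure_pair_measure_Times enn2real_mult)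
  also have "\<dots> \<le> measure (\<mu> \<Otimes>\<^sub>M L) ((\<lambda>(y, t). y * t) -` {z. R < \<bar>z\<bar>} \<inter> space (\<mu> \<Otimes>\<^sub>M L))"
  proof (rule P.finite_measure_mono)
    show "{y. \<delta> < \<bar>y\<bar>} \<times> {x. R / \<delta> < \<bar>x\<bar>}
      \<subseteq> (\<lambda>(y, t). y * t) -` {z. R < \<bar>z\<bar>} \<inter> space (\<mu> \<Otimes>\<^sub>M L)"
    proof clarify
      fix y x :: real assume yx: "\<delta> < \<bar>y\<bar>" "R / \<delta> < \<bar>x\<bar>"
      have "\<delta> * (R / \<delta>) < \<bar>y\<bar> * \<bar>x\<bar>"
        using yx pos by (intro mult_strict_mono) auto
      then show "(y, x) \<in> (\<lambda>(y, t). y * t) -` {z. R < \<bar>z\<bar>} \<inter> space (\<mu> \<Otimes>\<^sub>M L)"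
        using pos by (simp add: space_pair_measure abs_mult)
    qed
  qed measurable
  also have "\<dots> = measure (mixture \<mu> L) {z. R < \<bar>z\<bar>}"
    by (simp add: mixture_def measure_distr)
  finally show ?thesis .
qed

section \<open>Convolutions of mixtures of a weakly stable law\<close>

text \<open>Real and imaginary parts reduce this to the corresponding fact for bounded real functions.\<close>

lemma integral_bind_complex:
  fixes f :: "real \<Rightarrow> complex"
  assumes P: "prob_space P" and N [measurable]: "N \<in> measurable P (subprob_algebra borel)"
    and prob: "\<And>z. z \<in> space P \<Longrightarrow> prob_space (N z)"
    and [measurable]: "f \<in> borel_measurable borel" and bd: "\<And>x. cmod (f x) \<le> B"
  shows "(\<integral>x. f x \<partial>(P \<bind> N)) = (\<integral>z. (\<integral>x. f x \<partial>N z) \<partial>P)"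
proof -
  interpret P: prob_space P by fact
  have ne: "space P \<noteq> {}" by (rule P.not_empty)
  interpret B: prob_space "P \<bind> N"
    by (rule P.prob_space_bind[OF _ N]) (auto intro: prob)
  have sets_N: "sets (N z) = sets borel" if "z \<in> space P" for z
    using sets_kernel[OF N that] .
  have [simp]: "sets (P \<bind> N) = sets borel"
    by (rule sets_bind[OF sets_N ne])
  have [measurable]: "f \<in> borel_measurable (P \<bind> N)"
    by (simp cong: measurable_cong_sets)
  have int_B: "integrable (P \<bind> N) f"
    by (rule B.integrable_const_bound[of _ B]) (use bd in auto)
  have int_N: "integrable (N z) f" if "z \<in> space P" for z
  proof -
    interpret Nz: prob_space "N z" by (rule prob[OF that])
    have "f \<in> borel_measurable (N z)"
      by (simp add: sets_N[OF that] cong: measurable_cong_sets)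
    then show ?thesis
      by (intro Nz.integrable_const_bound[of _ B]) (use bd in auto)
  qed
  have bd_N: "cmod (\<integral>x. f x \<partial>N z) \<le> B" if "z \<in> space P" for z
  proof -
    interpret Nz: prob_space "N z" by (rule prob[OF that])
    have "cmod (\<integral>x. f x \<partial>N z) \<le> (\<integral>x. cmod (f x) \<partial>N z)" by simp
    also have "\<dots> \<le> (\<integral>x. B \<partial>N z)"
      using int_N[OF that] bd by (intro integral_mono) auto
    finally show ?thesis by (simp add: Nz.prob_space)
  qed
  have mass: "AE z in P. emeasure (N z) (space (N z)) \<le> ennreal 1"
    by (auto intro!: AE_I2 simp: prob_space.emeasure_space_1[OF prob])
  have real_bind: "(\<integral>x. g x \<partial>(P \<bind> N)) = (\<integral>z. (\<integral>x. g x \<partial>N z) \<partial>P)"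
    if "g \<in> borel_measurable borel" "\<And>x. \<bar>g x\<bar> \<le> B" for g :: "real \<Rightarrow> real"
    using that by (intro integral_bind[where K = borel and B = B and B' = 1] P.finite_measure_axioms mass N) auto
  have Re_N: "(\<integral>x. Re (f x) \<partial>N z) = Re (\<integral>x. f x \<partial>N z)"
    and Im_N: "(\<integral>x. Im (f x) \<partial>N z) = Im (\<integral>x. f x \<partial>N z)" if "z \<in> space P" for z
    using int_N[OF that] by auto
  have m_Re: "(\<lambda>z. \<integral>x. Re (f x) \<partial>N z) \<in> borel_measurable P"
   and m_Im: "(\<lambda>z. \<integral>x. Im (f x) \<partial>N z) \<in> borel_measurable P"
    by (intro integral_measurable_subprob_algebra[THEN measurable_compose[OF N]]; simp)+
  have m: "(\<lambda>z. \<integral>x. f x \<partial>N z) \<in> borel_measurable P"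
    unfolding borel_measurable_complex_iff
    using m_Re m_Im by (simp add: Re_N Im_N cong: measurable_cong)
  have int_P: "integrable P (\<lambda>z. \<integral>x. f x \<partial>N z)"
    using m bd_N by (intro P.integrable_const_bound[of _ B]) auto
  have "Re (\<integral>x. f x \<partial>(P \<bind> N)) = (\<integral>z. (\<integral>x. Re (f x) \<partial>N z) \<partial>P)"
    using real_bind[of "\<lambda>x. Re (f x)"] int_B order_trans[OF abs_Re_le_cmod bd] by simp
  also have "\<dots> = Re (\<integral>z. (\<integral>x. f x \<partial>N z) \<partial>P)"
    using int_P by (simp add: Re_N cong: Bochner_Integration.integral_cong)
  finally have 1: "Re (\<integral>x. f x \<partial>(P \<bind> N)) = Re (\<integral>z. (\<integral>x. f x \<partial>N z) \<partial>P)" .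
  have "Im (\<integral>x. f x \<partial>(P \<bind> N)) = (\<integral>z. (\<integral>x. Im (f x) \<partial>N z) \<partial>P)"
    using real_bind[of "\<lambda>x. Im (f x)"] int_B order_trans[OF abs_Im_le_cmod bd] by simp
  also have "\<dots> = Im (\<integral>z. (\<integral>x. f x \<partial>N z) \<partial>P)"
    using int_P by (simp add: Im_N cong: Bochner_Integration.integral_cong)
  finally show ?thesis using 1 by (simp add: complex_eq_iff)
qed

text \<open>If every such tail had measure \<open>0\<close>, then \<open>\<mu>\<close> would be concentrated at the origin and have
  an atom there.\<close>

lemma nontrivial_measure_tail:
  assumes "real_distribution \<mu>" "nontrivial_measure \<mu>"
  shows "\<exists>\<delta>>0. 0 < measure \<mu> {y. \<delta> < \<bar>y\<bar>}"
proof (rule ccontr)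
  interpret m: real_distribution \<mu> by fact
  assume "\<not> ?thesis"
  then have z: "\<And>\<delta>. 0 < \<delta> \<Longrightarrow> measure \<mu> {y. \<delta> < \<bar>y\<bar>} = 0"
    by (metis less_eq_real_def measure_nonneg)
  have "AE y in \<mu>. \<forall>n. \<not> 1 / real (Suc n) < \<bar>y\<bar>"
  proof (subst AE_all_countable, rule allI)
    fix n
    have "{y. 1 / real (Suc n) < \<bar>y\<bar>} \<in> null_sets \<mu>"
      using z[of "1 / real (Suc n)"] by (auto simp: null_sets_def m.emeasure_eq_measure)
    then show "AE y in \<mu>. \<not> 1 / real (Suc n) < \<bar>y\<bar>"
      by (rule AE_I') auto
  qed
  then have "AE y in \<mu>. y \<in> {0}"
  proof eventually_elim
    case (elim y)
    show ?case
    proof (rule ccontr)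
      assume "y \<notin> {0}"
      then obtain n where "inverse (real (Suc n)) < \<bar>y\<bar>"
        using reals_Archimedean[of "\<bar>y\<bar>"] by auto
      then show False using elim by (auto simp: inverse_eq_divide)
    qed
  qed
  then have "measure \<mu> {0} = 1"
    by (subst m.prob_eq_1) auto
  then show False
    using assms(2) by (simp add: nontrivial_measure_def)
qed

text \<open>This is the compactness that lets the mixing laws of approximations accumulate at a
  mixing law of the limit. It fails for \<open>\<mu>\<close> concentrated at the origin, where the mixture carries
  no information on the mixing law.\<close>

lemma tight_if_mixtures_converge:
  assumes \<mu>: "real_distribution \<mu>" "nontrivial_measure \<mu>"
    and rd: "\<And>n. real_distribution (L n)" "real_distribution K"
    and conv: "weak_conv_m (\<lambda>n. mixture \<mu> (L n)) K"
  shows "tight L"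
proof (rule tight_of_tails[OF rd(1)])
  fix e :: real assume e: "0 < e"
  obtain \<delta> where \<delta>: "0 < \<delta>" and p: "0 < measure \<mu> {y. \<delta> < \<bar>y\<bar>}"
    using nontrivial_measure_tail[OF \<mu>] by blast
  let ?p = "measure \<mu> {y. \<delta> < \<bar>y\<bar>}"
  obtain R where R: "0 < R"
    and ev: "\<forall>\<^sub>F n in sequentially. measure (mixture \<mu> (L n)) {z. R < \<bar>z\<bar>} < ?p * e"
    using weak_conv_m_tails[OF real_distribution_mixture[OF \<mu>(1) rd(1)] rd(2) conv, of "?p * e"] p e
    by auto
  from ev have "\<forall>\<^sub>F n in sequentially. measure (L n) {x. R / \<delta> < \<bar>x\<bar>} < e"
  proof eventually_elim
    case (elim n)
    with measure_mixture_tail[OF \<mu>(1) rd(1) R \<delta>, of n]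
    have "?p * measure (L n) {x. R / \<delta> < \<bar>x\<bar>} < ?p * e" by linarith
    then show ?case using p by simp
  qed
  then show "\<exists>R. \<forall>\<^sub>F n in sequentially. measure (L n) {x. R < \<bar>x\<bar>} < e" by blast
qed

text \<open>Rounding to the grid of mesh \<open>1 / (n + 1)\<close> takes countably many values, which is why it is
  used below to discretise a law.\<close>

lemma floor_grid_tendsto:
  fixes x :: real
  shows "(\<lambda>n. of_int \<lfloor>real (Suc n) * x\<rfloor> / real (Suc n)) \<longlonglongrightarrow> x"
proof (rule tendsto_sandwich[where f = "\<lambda>n. x - inverse (real (Suc n))" and h = "\<lambda>n. x"])
  show "\<forall>\<^sub>F n in sequentially. x - inverse (real (Suc n)) \<le> of_int \<lfloor>real (Suc n) * x\<rfloor> / real (Suc n)"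
  proof (rule always_eventually, rule allI)
    fix n
    have "real (Suc n) * x - 1 \<le> of_int \<lfloor>real (Suc n) * x\<rfloor>" by linarith
    then have "(real (Suc n) * x - 1) / real (Suc n) \<le> of_int \<lfloor>real (Suc n) * x\<rfloor> / real (Suc n)"
      by (rule divide_right_mono) simp
    then show "x - inverse (real (Suc n)) \<le> of_int \<lfloor>real (Suc n) * x\<rfloor> / real (Suc n)"
      by (simp add: diff_divide_distrib inverse_eq_divide del: of_nat_Suc)
  qed
  show "\<forall>\<^sub>F n in sequentially. of_int \<lfloor>real (Suc n) * x\<rfloor> / real (Suc n) \<le> x"
  proof (rule always_eventually, rule allI)
    fix n
    have "of_int \<lfloor>real (Suc n) * x\<rfloor> \<le> real (Suc n) * x" by linarith
    then show "of_int \<lfloor>real (Suc n) * x\<rfloor> / real (Suc n) \<le> x"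
      by (subst pos_divide_le_eq) (auto simp: mult.commute simp del: of_nat_Suc)
  qed
  show "(\<lambda>n. x - inverse (real (Suc n))) \<longlonglongrightarrow> x"
    using tendsto_diff[OF tendsto_const LIMSEQ_inverse_real_of_nat, of x] by simp
qed simp

text \<open>Weak stability provides a law \<open>\<Lambda> a b\<close> for each pair of scales. For random scales one would
  like to integrate \<open>\<Lambda> a b\<close> over \<open>L1\<close> and \<open>L2\<close>, but \<open>\<Lambda>\<close> is an arbitrary choice and need not be
  measurable. Rounding the scales to a grid leaves countably many pairs, so the choice becomes
  measurable and gives a mixing law \<open>L n\<close> for the rounded problem. As the mesh shrinks, the
  characteristic functions of \<open>mixture \<mu> (L n)\<close> converge to that of the convolution; hence the
  \<open>L n\<close> are tight, and any weak limit point of them is a mixing law for the original problem.\<close>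

lemma weakly_stable_convolution_of_mixtures:
  assumes ws: "weakly_stable \<mu>" and nt: "nontrivial_measure \<mu>"
    and L1: "real_distribution L1" and L2: "real_distribution L2"
  shows "\<exists>L. real_distribution L \<and> (mixture \<mu> L1 \<star> mixture \<mu> L2) = mixture \<mu> L"
proof -
  have \<mu>: "real_distribution \<mu>" using ws by (simp add: weakly_stable_def)
  interpret m: real_distribution \<mu> by (rule \<mu>)
  interpret l1: real_distribution L1 by (rule L1)
  interpret l2: real_distribution L2 by (rule L2)
  interpret PP: pair_prob_space L1 L2 ..
  define Q where "Q = (mixture \<mu> L1 \<star> mixture \<mu> L2)"
  have Q: "real_distribution Q"
    unfolding Q_def by (intro real_distribution_convolution real_distribution_mixture \<mu> L1 L2)
  obtain \<Lambda> where \<Lambda>: "\<And>a b. real_distribution (\<Lambda> a b)"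
    and \<Lambda>_eq: "\<And>a b. (rescale a \<mu> \<star> rescale b \<mu>) = mixture \<mu> (\<Lambda> a b)"
    using ws unfolding weakly_stable_def by metis
  define k :: "nat \<Rightarrow> real \<Rightarrow> real" where "k n x = of_int \<lfloor>real (Suc n) * x\<rfloor> / real (Suc n)" for n x
  have [measurable]: "k n \<in> borel_measurable borel" for n
    unfolding k_def by measurable
  define N where "N n z = \<Lambda> (k n (fst z)) (k n (snd z))" for n and z :: "real \<times> real"
  \<comment> \<open>Fixing the grid indices makes the kernel constant; countability of the grid does the rest.\<close>
  have N_meas: "N n \<in> measurable (L1 \<Otimes>\<^sub>M L2) (subprob_algebra borel)" for n
  proof -
    have "\<Lambda> a b \<in> space (subprob_algebra borel)" for a b
    proof -
      interpret real_distribution "\<Lambda> a b" by (rule \<Lambda>)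
      show ?thesis by (simp add: space_subprob_algebra subprob_space_axioms)
    qed
    then have const: "(\<lambda>z. \<Lambda> a b) \<in> measurable (L1 \<Otimes>\<^sub>M L2) (subprob_algebra borel)" for a b
      by (rule measurable_const)
    have "(\<lambda>z. \<Lambda> (of_int i / real (Suc n)) (k n (snd z))) \<in> measurable (L1 \<Otimes>\<^sub>M L2) (subprob_algebra borel)" for i
      unfolding k_def
      by (rule measurable_compose_countable[where
            f = "\<lambda>j z. \<Lambda> (of_int i / real (Suc n)) (of_int j / real (Suc n))"
            and g = "\<lambda>z. \<lfloor>real (Suc n) * snd z\<rfloor>", OF const]) measurable
    then have "(\<lambda>z. \<Lambda> (of_int \<lfloor>real (Suc n) * fst z\<rfloor> / real (Suc n)) (k n (snd z)))
        \<in> measurable (L1 \<Otimes>\<^sub>M L2) (subprob_algebra borel)"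
      by (rule measurable_compose_countable[where
            f = "\<lambda>i z. \<Lambda> (of_int i / real (Suc n)) (k n (snd z))"
            and g = "\<lambda>z. \<lfloor>real (Suc n) * fst z\<rfloor>"]) measurable
    then show ?thesis by (simp add: N_def[abs_def] k_def del: of_nat_Suc)
  qed
  define L where "L n = (L1 \<Otimes>\<^sub>M L2) \<bind> N n" for n
  have N_prob: "prob_space (N n z)" for n z
    using \<Lambda> by (simp add: N_def real_distribution_def)
  have L: "real_distribution (L n)" for n
  proof -
    have "prob_space (L n)"
      unfolding L_def by (rule PP.P.prob_space_bind[OF _ N_meas]) (simp add: N_prob)
    moreover have "sets (L n) = sets borel"
      unfolding L_def
    proof (rule sets_bind[OF _ PP.P.not_empty])
      show "sets (N n z) = sets borel" for z
        using \<Lambda> by (simp add: N_def real_distribution_def real_distribution_axioms_def)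
    qed
    ultimately show ?thesis by (simp add: real_distribution_def real_distribution_axioms_def)
  qed
  have char_L: "char (mixture \<mu> (L n)) t
      = (\<integral>z. char \<mu> (t * k n (fst z)) * char \<mu> (t * k n (snd z)) \<partial>(L1 \<Otimes>\<^sub>M L2))" for n t
  proof -
    have "char (mixture \<mu> (L n)) t = (\<integral>x. char \<mu> (t * x) \<partial>L n)"
      by (rule char_mixture[OF \<mu> L])
    also have "\<dots> = (\<integral>z. (\<integral>x. char \<mu> (t * x) \<partial>N n z) \<partial>(L1 \<Otimes>\<^sub>M L2))"
      unfolding L_def
      by (rule integral_bind_complex[where B = 1])
         (auto intro: PP.P.prob_space_axioms N_meas N_prob m.cmod_char_le_1)
    also have "\<dots> = (\<integral>z. char \<mu> (t * k n (fst z)) * char \<mu> (t * k n (snd z)) \<partial>(L1 \<Otimes>\<^sub>M L2))"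
      by (intro Bochner_Integration.integral_cong refl)
         (simp add: N_def char_mixture[OF \<mu> \<Lambda>, symmetric] \<Lambda>_eq[symmetric]
            char_convolution[OF real_distribution_rescale[OF \<mu>] real_distribution_rescale[OF \<mu>]]
            char_rescale[OF \<mu>])
    finally show ?thesis .
  qed
  have bd: "cmod (char \<mu> s * char \<mu> s') \<le> 1" for s s'
    using mult_mono[OF m.cmod_char_le_1 m.cmod_char_le_1, of s s'] by (simp add: norm_mult mult.commute)
  have lim: "(\<lambda>n. char (mixture \<mu> (L n)) t) \<longlonglongrightarrow> char Q t" for t
  proof -
    have "(\<lambda>n. \<integral>z. char \<mu> (t * k n (fst z)) * char \<mu> (t * k n (snd z)) \<partial>(L1 \<Otimes>\<^sub>M L2))
      \<longlonglongrightarrow> (\<integral>z. char \<mu> (t * fst z) * char \<mu> (t * snd z) \<partial>(L1 \<Otimes>\<^sub>M L2))"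
    proof (rule integral_dominated_convergence[where w = "\<lambda>_. 1"])
      show "AE z in L1 \<Otimes>\<^sub>M L2. (\<lambda>n. char \<mu> (t * k n (fst z)) * char \<mu> (t * k n (snd z)))
          \<longlonglongrightarrow> char \<mu> (t * fst z) * char \<mu> (t * snd z)"
        unfolding k_def
        by (intro AE_I2 tendsto_mult isCont_tendsto_compose[OF m.isCont_char] tendsto_const floor_grid_tendsto)
    qed (auto simp: bd)
    also have "(\<integral>z. char \<mu> (t * fst z) * char \<mu> (t * snd z) \<partial>(L1 \<Otimes>\<^sub>M L2))
        = (\<integral>x. \<integral>y. char \<mu> (t * x) * char \<mu> (t * y) \<partial>L2 \<partial>L1)"
      by (subst PP.integral_fst'[symmetric]) (auto intro!: PP.P.integrable_const_bound[where B = 1] simp: bd)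
    also have "\<dots> = char Q t"
      by (simp add: Q_def char_convolution real_distribution_mixture \<mu> L1 L2 char_mixture)
    finally show ?thesis by (simp add: char_L)
  qed
  have conv: "weak_conv_m (\<lambda>n. mixture \<mu> (L n)) Q"
    by (rule levy_continuity[OF real_distribution_mixture[OF \<mu> L] Q lim])
  have "tight L"
    by (rule tight_if_mixtures_converge[OF \<mu> nt L Q conv])
  \<comment> \<open>Along a subsequence the characteristic functions of the mixtures have two limits, which must
     agree.\<close>
  from tight_imp_convergent_subsubsequence[OF this strict_mono_id]
  obtain r L' where r: "strict_mono r" and L': "real_distribution L'" "weak_conv_m (L \<circ> r) L'"
    by (auto simp: o_def id_def)
  have "char Q t = char (mixture \<mu> L') t" for t
  proof (rule LIMSEQ_unique)
    show "(\<lambda>n. char (mixture \<mu> (L (r n))) t) \<longlonglongrightarrow> char Q t"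
      using LIMSEQ_subseq_LIMSEQ[OF lim r, of t] by (simp add: o_def)
    have "(\<lambda>n. \<integral>x. char \<mu> (t * x) \<partial>(L \<circ> r) n) \<longlonglongrightarrow> (\<integral>x. char \<mu> (t * x) \<partial>L')"
    proof (rule weak_conv_imp_integral_bdd_continuous_conv[where B = 1])
      show "isCont (\<lambda>x. char \<mu> (t * x)) x" for x
        by (intro continuous_within_compose3[OF m.isCont_char] continuous_intros)
    qed (use L L' m.cmod_char_le_1 in \<open>auto simp: o_def\<close>)
    then show "(\<lambda>n. char (mixture \<mu> (L (r n))) t) \<longlonglongrightarrow> char (mixture \<mu> L') t"
      by (simp add: char_mixture \<mu> L L')
  qed
  then have "Q = mixture \<mu> L'"
    by (intro Levy_uniqueness Q real_distribution_mixture \<mu> L' ext)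
  with L' show ?thesis unfolding Q_def by blast
qed

section \<open>The weak generalized convolution\<close>

text \<open>A fair coin independent of \<open>\<theta>\<close> decides the sign in front of \<open>\<bar>\<theta>\<bar>\<close>. Having the symmetrization
  as the law of a random variable turns integrals against it into iterated integrals.\<close>

lemma symmetrization_eq_distr:
  assumes "real_distribution L"
  shows "symmetrization L = distr (measure_pmf (bernoulli_pmf (1/2)) \<Otimes>\<^sub>M L) borel
    (\<lambda>(s, x). if s then \<bar>x\<bar> else - \<bar>x\<bar>)" (is "_ = distr ?P borel ?g")
proof (rule measure_eqI)
  interpret l: real_distribution L by fact
  have [measurable]: "?g \<in> borel_measurable ?P" by measurable
  fix A assume "A \<in> sets (symmetrization L)"
  then have A [measurable]: "A \<in> sets borel" by simp
  have "emeasure (distr ?P borel ?g) A = emeasure ?P (?g -` A \<inter> space ?P)"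
    by (simp add: emeasure_distr)
  also have "\<dots> = (\<integral>\<^sup>+s. emeasure L (Pair s -` (?g -` A \<inter> space ?P)) \<partial>measure_pmf (bernoulli_pmf (1/2)))"
    by (rule l.emeasure_pair_measure_alt) measurable
  also have "\<dots> = (1/2) * emeasure L {x. \<bar>x\<bar> \<in> A} + (1/2) * emeasure L {x. - \<bar>x\<bar> \<in> A}"
    by (simp add: space_pair_measure vimage_def mult.commute inverse_eq_divide divide_ennreal_def ennreal_half)
  also have "\<dots> = emeasure (symmetrization L) A"
    by (simp add: emeasure_symmetrization[OF A] abs_law_def rescale_def emeasure_distr vimage_def)
  finally show "emeasure (symmetrization L) A = emeasure (distr ?P borel ?g) A" by simp
qed simp

lemma char_even:
  assumes "real_distribution \<mu>" "symmetric_measure \<mu>"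
  shows "char \<mu> (- t) = char \<mu> t"
  using char_rescale[OF assms(1), of "-1" t] assms(2) by (simp add: symmetric_measure_def)

lemma real_distribution_symmetrization:
  assumes "real_distribution L"
  shows "real_distribution (symmetrization L)"
proof -
  interpret l: real_distribution L by fact
  interpret pair_prob_space "measure_pmf (bernoulli_pmf (1/2))" L ..
  show ?thesis
    unfolding symmetrization_eq_distr[OF assms] by (intro real_distribution_distr) measurable
qed

text \<open>The characteristic function of a symmetric \<open>\<mu>\<close> is even, so the sign of the mixing variable
  does not influence the mixture. Hence symmetrizing in the definition of the weak generalized
  convolution keeps the defining identity intact.\<close>

lemma mixture_symmetrization:
  assumes "real_distribution \<mu>" "real_distribution L" and sym: "symmetric_measure \<mu>"
  shows "mixture \<mu> (symmetrization L) = mixture \<mu> L"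
proof (intro Levy_uniqueness real_distribution_mixture real_distribution_symmetrization assms ext)
  interpret m: real_distribution \<mu> by fact
  interpret l: real_distribution L by fact
  interpret P: pair_prob_space "measure_pmf (bernoulli_pmf (1/2))" L ..
  fix t
  have abs: "char \<mu> (t * (if s then \<bar>x\<bar> else - \<bar>x\<bar>)) = char \<mu> (t * x)" for s x
    using char_even[OF assms(1) sym, of "t * x"] by (auto simp: abs_if)
  have "char (mixture \<mu> (symmetrization L)) t = (\<integral>x. char \<mu> (t * x) \<partial>symmetrization L)"
    by (intro char_mixture real_distribution_symmetrization assms)
  also have "\<dots> = (\<integral>z. char \<mu> (t * snd z) \<partial>(measure_pmf (bernoulli_pmf (1/2)) \<Otimes>\<^sub>M L))"
    unfolding symmetrization_eq_distr[OF assms(2)]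
    by (subst integral_distr) (auto simp: case_prod_beta' abs)
  also have "\<dots> = (\<integral>s. \<integral>x. char \<mu> (t * x) \<partial>L \<partial>measure_pmf (bernoulli_pmf (1/2)))"
    by (subst P.integral_fst'[symmetric])
       (auto intro!: P.P.integrable_const_bound[where B = 1] simp: m.cmod_char_le_1)
  also have "\<dots> = char (mixture \<mu> L) t"
    by (simp add: char_mixture assms)
  finally show "char (mixture \<mu> (symmetrization L)) t = char (mixture \<mu> L) t" .
qed

text \<open>By \<open>weakly_stable_convolution_of_mixtures\<close> the choice operator in the definition yields a
  mixing law of the convolution, and symmetrizing it preserves the mixture.\<close>

lemma weak_conv_mixture:
  assumes ws: "weakly_stable \<mu>" "nontrivial_measure \<mu>"
    and L: "real_distribution L1" "real_distribution L2"
  shows "real_distribution (weak_conv \<mu> L1 L2)"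
    and "mixture \<mu> (weak_conv \<mu> L1 L2) = (mixture \<mu> L1 \<star> mixture \<mu> L2)"
proof -
  have \<mu>: "real_distribution \<mu>" using ws by (simp add: weakly_stable_def)
  define L where "L = (SOME L. real_distribution L \<and> (mixture \<mu> L1 \<star> mixture \<mu> L2) = mixture \<mu> L)"
  have *: "real_distribution L \<and> (mixture \<mu> L1 \<star> mixture \<mu> L2) = mixture \<mu> L"
    unfolding L_def by (rule someI_ex[OF weakly_stable_convolution_of_mixtures[OF ws L]])
  have wc: "weak_conv \<mu> L1 L2 = (if symmetric_measure \<mu> then symmetrization L else L)"
    by (simp add: weak_conv_def L_def)
  show "real_distribution (weak_conv \<mu> L1 L2)"
    using * by (simp add: wc real_distribution_symmetrization)
  show "mixture \<mu> (weak_conv \<mu> L1 L2) = (mixture \<mu> L1 \<star> mixture \<mu> L2)"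
    using * by (simp add: wc mixture_symmetrization \<mu>)
qed

lemma char_weak_conv:
  assumes ws: "weakly_stable \<mu>" "nontrivial_measure \<mu>"
    and L: "real_distribution L1" "real_distribution L2"
  shows "char (mixture \<mu> (weak_conv \<mu> L1 L2)) t = char (mixture \<mu> L1) t * char (mixture \<mu> L2) t"
  using ws L by (simp add: weak_conv_mixture char_convolution real_distribution_mixture weakly_stable_def)

lemma char_mixture_return_0:
  assumes "real_distribution \<mu>"
  shows "char (mixture \<mu> (return borel 0)) t = 1"
proof -
  interpret m: real_distribution \<mu> by fact
  show ?thesis
    by (simp add: char_mixture[OF assms real_distribution_return] integral_return m.char_zero)
qed

text \<open>Under \<open>mixture \<mu>\<close> the generalized convolution becomes ordinary convolution, so its powers
  become powers of one characteristic function. The first power is \<open>\<nu>\<close> rather than its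
  symmetrization, but for symmetric \<open>\<mu>\<close> both have the same mixture, so the formula is uniform in
  \<open>n\<close>.\<close>

lemma char_mixture_weak_conv_power:
  assumes ws: "weakly_stable \<mu>" "nontrivial_measure \<mu>" and \<nu>: "real_distribution \<nu>"
  shows "real_distribution (weak_conv_power \<mu> \<nu> n) \<and>
    char (mixture \<mu> (weak_conv_power \<mu> \<nu> n)) t = char (mixture \<mu> \<nu>) t ^ n"
proof (induction n)
  case 0
  show ?case
    using ws by (simp add: char_mixture_return_0 real_distribution_return weakly_stable_def)
next
  case (Suc n)
  then show ?case
    using \<nu> by (cases n) (auto simp: weak_conv_mixture(1)[OF ws] char_weak_conv[OF ws])
qed

section \<open>Laws of the random walk and of the randomized sum\<close>

text \<open>The transition probabilities from time \<open>0\<close>: the walk starts at the origin almost surely, so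
  the conditional probability given the past at time \<open>0\<close> is almost surely the constant on the right,
  and its expectation is the unconditional probability.\<close>

lemma weak_random_walk_law:
  assumes M: "prob_space M" and ws: "weakly_stable \<mu>" "nontrivial_measure \<mu>"
    and \<nu>: "real_distribution \<nu>"
    and walk: "weak_random_walk M \<mu> \<nu> X" and n: "0 < n"
  shows "distr M borel (X n) = weak_conv \<mu> (return borel 0) (weak_conv_power \<mu> \<nu> n)" (is "_ = ?K")
proof -
  interpret prob_space M by fact
  have X [measurable]: "X i \<in> borel_measurable M" for i
    using walk by (simp add: weak_random_walk_def)
  interpret K: real_distribution ?K
    by (intro weak_conv_mixture ws real_distribution_return char_mixture_weak_conv_power[THEN conjunct1] \<nu>)
  interpret D: prob_space "distr M borel (X n)" by (rule prob_space_distr) simp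
  let ?F = "past M X 0"
  have "subalgebra M ?F"
  proof -
    have "{X i -` A \<inter> space M |i A. i \<le> 0 \<and> A \<in> sets borel} \<subseteq> sets M"
      by (auto intro: measurable_sets[OF X])
    then show ?thesis
      unfolding subalgebra_def past_def
      by (simp add: sets_measure_of_conv space_measure_of_conv sets.sigma_sets_subset sets.space_closed)
  qed
  then interpret F: finite_measure_subalgebra M ?F
    by unfold_locales
  show ?thesis
  proof (rule measure_eqI)
    fix A assume "A \<in> sets (distr M borel (X n))"
    then have A [measurable]: "A \<in> sets borel" by simp
    have int: "integrable M (\<lambda>\<omega>. indicator A (X n \<omega>) :: real)"
      by (rule integrable_const_bound[where B = 1]) auto
    have "AE \<omega> in M. real_cond_exp M ?F (\<lambda>\<omega>. indicator A (X n \<omega>)) \<omega>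
        = measure (weak_conv \<mu> (return borel (X 0 \<omega>)) (weak_conv_power \<mu> \<nu> (n - 0))) A"
      using walk A n unfolding weak_random_walk_def by blast
    moreover have "AE \<omega> in M. X 0 \<omega> = 0"
      using walk by (simp add: weak_random_walk_def)
    ultimately have AE: "AE \<omega> in M. real_cond_exp M ?F (\<lambda>\<omega>. indicator A (X n \<omega>)) \<omega> = measure ?K A"
      by eventually_elim simp
    have "measure (distr M borel (X n)) A = (\<integral>\<omega>. indicator A (X n \<omega>) \<partial>M)"
    proof -
      have "(\<integral>\<omega>. indicator A (X n \<omega>) \<partial>M) = (\<integral>x. indicator A x \<partial>distr M borel (X n) :: real)"
        by (rule integral_distr[symmetric]) auto
      then show ?thesis by simp
    qed
    also have "\<dots> = (\<integral>\<omega>. real_cond_exp M ?F (\<lambda>\<omega>. indicator A (X n \<omega>)) \<omega> \<partial>M)"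
      by (rule F.real_cond_exp_int(2)[OF int, symmetric])
    also have "\<dots> = (\<integral>\<omega>. measure ?K A \<partial>M)"
      by (rule integral_cong_AE) (use AE in auto)
    also have "\<dots> = measure ?K A" by (simp add: prob_space)
    finally show "emeasure (distr M borel (X n)) A = emeasure ?K A"
      by (simp add: D.emeasure_eq_measure K.emeasure_eq_measure)
  qed simp
qed

text \<open>Two independent families that are independent of each other form one independent family,
  indexed by the disjoint sum. Regrouping this family then yields independent pairs.\<close>

lemma (in prob_space) indep_vars_case_sum:
  assumes X: "indep_vars (\<lambda>_. borel) X I" and Y: "indep_vars (\<lambda>_. borel) Y J"
    and XY: "indep_var (Pi\<^sub>M I (\<lambda>_. borel)) (\<lambda>\<omega>. \<lambda>i\<in>I. X i \<omega>) (Pi\<^sub>M J (\<lambda>_. borel)) (\<lambda>\<omega>. \<lambda>j\<in>J. Y j \<omega>)"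
  shows "indep_vars (\<lambda>_. borel) (case_sum X Y) (I <+> J)"
  unfolding indep_vars_def2
proof (intro conjI indep_setsI ballI)
  fix k assume "k \<in> I <+> J"
  then show rv: "random_variable borel (case_sum X Y k)"
    using X Y by (auto simp: indep_vars_def2)
  then show "{case_sum X Y k -` A \<inter> space M | A. A \<in> sets borel} \<subseteq> events"
    by (auto intro: measurable_sets)
next
  fix A K assume K: "K \<noteq> {}" "K \<subseteq> I <+> J" "finite K"
    and "\<forall>k\<in>K. A k \<in> {case_sum X Y k -` B \<inter> space M | B. B \<in> sets borel}"
  then obtain B where B: "\<And>k. k \<in> K \<Longrightarrow> A k = case_sum X Y k -` B k \<inter> space M"
    "\<And>k. k \<in> K \<Longrightarrow> B k \<in> sets borel"
    by (simp, metis)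
  define P Q where "P = Inl -` K" and "Q = Inr -` K"
  have K_eq: "K = Inl ` P \<union> Inr ` Q"
    unfolding P_def Q_def by (auto simp: image_iff) (metis sum.exhaust)
  have PQ: "finite P" "finite Q" "P \<subseteq> I" "Q \<subseteq> J"
    using K by (auto simp: P_def Q_def intro: finite_vimageI)
  have BX: "B (Inl i) \<in> sets borel" if "i \<in> P" for i using that B by (auto simp: P_def)
  have BY: "B (Inr i) \<in> sets borel" if "i \<in> Q" for i using that B by (auto simp: Q_def)
  let ?CX = "{f \<in> space (Pi\<^sub>M I (\<lambda>_. borel)). \<forall>i\<in>P. f i \<in> B (Inl i)}"
  let ?CY = "{f \<in> space (Pi\<^sub>M J (\<lambda>_. borel)). \<forall>i\<in>Q. f i \<in> B (Inr i)}"
  let ?EX = "{\<omega> \<in> space M. \<forall>i\<in>P. X i \<omega> \<in> B (Inl i)}"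
  let ?EY = "{\<omega> \<in> space M. \<forall>i\<in>Q. Y i \<omega> \<in> B (Inr i)}"
  have CX: "?CX \<in> sets (Pi\<^sub>M I (\<lambda>_. borel))"
    using PQ BX by (intro sets.sets_Collect_finite_All measurable_sets_Collect[OF measurable_component_singleton]) auto
  have CY: "?CY \<in> sets (Pi\<^sub>M J (\<lambda>_. borel))"
    using PQ BY by (intro sets.sets_Collect_finite_All measurable_sets_Collect[OF measurable_component_singleton]) auto
  have eX: "(\<lambda>\<omega>. \<lambda>i\<in>I. X i \<omega>) -` ?CX \<inter> space M = ?EX"
    using PQ by (auto simp: space_PiM)
  have eY: "(\<lambda>\<omega>. \<lambda>j\<in>J. Y j \<omega>) -` ?CY \<inter> space M = ?EY"
    using PQ by (auto simp: space_PiM)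
  have AK: "(\<Inter>k\<in>K. A k) = ?EX \<inter> ?EY"
  proof (intro set_eqI iffI)
    fix \<omega> assume "\<omega> \<in> (\<Inter>k\<in>K. A k)"
    then have "\<omega> \<in> A k" if "k \<in> K" for k
      using that by simp
    then have "\<omega> \<in> case_sum X Y k -` B k \<inter> space M" if "k \<in> K" for k
      using that B(1) by blast
    from this this[of "Inl _"] this[of "Inr _"] show "\<omega> \<in> ?EX \<inter> ?EY"
      using K(1) by (auto simp: P_def Q_def)
  next
    fix \<omega> assume \<omega>: "\<omega> \<in> ?EX \<inter> ?EY"
    show "\<omega> \<in> (\<Inter>k\<in>K. A k)"
    proof
      fix k assume "k \<in> K"
      then show "\<omega> \<in> A k"
        using \<omega> B(1) by (cases k) (auto simp: P_def Q_def)
    qed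
  qed
  have "prob (\<Inter>k\<in>K. A k) = prob ((\<lambda>\<omega>. (\<lambda>i\<in>I. X i \<omega>, \<lambda>j\<in>J. Y j \<omega>)) -` (?CX \<times> ?CY) \<inter> space M)"
    unfolding AK eX[symmetric] eY[symmetric] by (rule arg_cong[where f = prob]) auto
  also have "\<dots> = prob ?EX * prob ?EY"
    unfolding indep_varD[OF XY CX CY] eX eY ..
  also have "prob ?EX = (\<Prod>i\<in>P. prob (A (Inl i)))"
  proof (cases "P = {}")
    case False
    have "?EX = (\<Inter>i\<in>P. X i -` B (Inl i) \<inter> space M)" using False by auto
    then show ?thesis
      using indep_varsD[OF X False PQ(1,3) BX] B(1) by (simp add: P_def)
  qed (simp add: prob_space)
  also have "prob ?EY = (\<Prod>i\<in>Q. prob (A (Inr i)))"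
  proof (cases "Q = {}")
    case False
    have "?EY = (\<Inter>i\<in>Q. Y i -` B (Inr i) \<inter> space M)" using False by auto
    then show ?thesis
      using indep_varsD[OF Y False PQ(2,4) BY] B(1) by (simp add: Q_def)
  qed (simp add: prob_space)
  also have "(\<Prod>i\<in>P. prob (A (Inl i))) * (\<Prod>i\<in>Q. prob (A (Inr i))) = (\<Prod>k\<in>K. prob (A k))"
    unfolding K_eq using PQ
    by (subst prod.union_disjoint) (auto simp: prod.reindex inj_on_def)
  finally show "prob (\<Inter>k\<in>K. A k) = (\<Prod>k\<in>K. prob (A k))" .
qed

lemma (in prob_space) indep_vars_paired:
  assumes Z: "indep_vars (\<lambda>_. borel) (case_sum X Y) (I <+> I)"
    and [measurable]: "case_prod f \<in> borel_measurable (borel \<Otimes>\<^sub>M borel)"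
  shows "indep_vars (\<lambda>_. borel) (\<lambda>i \<omega>. f (X i \<omega>) (Y i \<omega>)) I"
proof -
  have "indep_vars (\<lambda>i. Pi\<^sub>M {Inl i, Inr i} (\<lambda>_. borel))
      (\<lambda>i \<omega>. restrict (\<lambda>k. case_sum X Y k \<omega>) {Inl i, Inr i}) I"
    by (rule indep_vars_restrict[OF Z]) (auto simp: disjoint_family_on_def)
  then have "indep_vars (\<lambda>_. borel) (\<lambda>i \<omega>. (\<lambda>g. f (g (Inl i)) (g (Inr i)))
      (restrict (\<lambda>k. case_sum X Y k \<omega>) {Inl i, Inr i})) I"
    by (rule indep_vars_compose2) measurable
  then show ?thesis by simp
qed

lemma (in prob_space) indep_vars_imp_indep_var:
  assumes "indep_vars (\<lambda>_. N) Z I" "i \<in> I" "j \<in> I" "i \<noteq> j"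
  shows "indep_var N (Z i) N (Z j)"
proof -
  have "indep_var N ((\<lambda>g. g i) \<circ> (\<lambda>\<omega>. restrict (\<lambda>k. Z k \<omega>) {i}))
      N ((\<lambda>g. g j) \<circ> (\<lambda>\<omega>. restrict (\<lambda>k. Z k \<omega>) {j}))"
    using assms by (intro indep_var_compose[OF indep_var_restrict[OF assms(1)]]) auto
  then show ?thesis by (simp add: o_def)
qed

lemma (in prob_space) distr_times_indep:
  assumes ind: "indep_var borel U borel T"
  shows "distr M borel (\<lambda>\<omega>. T \<omega> * U \<omega>) = mixture (distr M borel U) (distr M borel T)"
proof -
  have [measurable]: "T \<in> borel_measurable M" "U \<in> borel_measurable M"
    using ind by (auto dest: indep_var_rv1 indep_var_rv2)
  show ?thesis
    using ind unfolding mixture_def indep_var_distribution_eq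
    by (simp add: distr_distr o_def mult.commute)
qed

section \<open>Moments and the almost sure bound\<close>

lemma abs_moment_mixture:
  assumes "real_distribution \<mu>" "real_distribution L"
  shows "abs_moment (mixture \<mu> L) p = abs_moment \<mu> p * abs_moment L p"
proof -
  interpret m: real_distribution \<mu> by fact
  interpret l: real_distribution L by fact
  have "abs_moment (mixture \<mu> L) p = (\<integral>\<^sup>+z. ennreal (\<bar>fst z * snd z\<bar> powr p) \<partial>(\<mu> \<Otimes>\<^sub>M L))"
    by (simp add: abs_moment_def mixture_def nn_integral_distr case_prod_beta')
  also have "\<dots> = (\<integral>\<^sup>+y. \<integral>\<^sup>+t. ennreal (\<bar>y\<bar> powr p) * ennreal (\<bar>t\<bar> powr p) \<partial>L \<partial>\<mu>)"
    by (subst l.nn_integral_fst[symmetric]) (auto simp: abs_mult powr_mult ennreal_mult)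
  also have "\<dots> = abs_moment \<mu> p * abs_moment L p"
    by (simp add: nn_integral_cmult nn_integral_multc abs_moment_def)
  finally show ?thesis .
qed

lemma abs_moment_pos:
  assumes "real_distribution \<mu>" "nontrivial_measure \<mu>"
  shows "0 < abs_moment \<mu> p"
proof (rule ccontr)
  interpret m: real_distribution \<mu> by fact
  assume "\<not> 0 < abs_moment \<mu> p"
  then have "AE x in \<mu>. x \<in> {0}"
    by (simp add: abs_moment_def nn_integral_0_iff_AE powr_def ennreal_eq_0_iff split: if_splits)
  then have "measure \<mu> {0} = 1" by (subst m.prob_eq_1) auto
  then show False using assms by (simp add: nontrivial_measure_def)
qed

text \<open>Markov's inequality for \<open>\<bar>Z\<bar> powr p\<close> when \<open>m\<close> is finite. When \<open>m\<close> is infinite, the bound on the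
  product forces \<open>Z = 0\<close> almost surely; the threshold is then \<open>0\<close>, because a finite number divided
  by \<open>\<infinity>\<close> is \<open>0\<close>, and it is exceeded with probability \<open>0\<close>.\<close>

lemma (in prob_space) moment_tail_bound:
  fixes Z :: "'a \<Rightarrow> real" and m :: ennreal
  assumes [measurable]: "Z \<in> borel_measurable M"
    and pos: "0 < p" "0 < B" "0 < c" "0 \<le> K" "0 < m"
    and bound: "m * (\<integral>\<^sup>+\<omega>. ennreal (\<bar>Z \<omega>\<bar> powr p) \<partial>M) \<le> ennreal (K * B)"
  shows "prob {\<omega> \<in> space M. enn2real (ennreal (c * B) / m) powr (1 / p) < \<bar>Z \<omega>\<bar>} \<le> K / c"
proof (cases "m = \<infinity>")
  case True
  have "(\<integral>\<^sup>+\<omega>. ennreal (\<bar>Z \<omega>\<bar> powr p) \<partial>M) = 0"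
    using bound True by (auto simp: ennreal_top_mult top_unique split: if_splits)
  then have "AE \<omega> in M. Z \<omega> = 0"
    by (simp add: nn_integral_0_iff_AE ennreal_eq_0_iff)
  then have "prob {\<omega> \<in> space M. enn2real (ennreal (c * B) / m) powr (1 / p) < \<bar>Z \<omega>\<bar>} = 0"
    by (subst prob_eq_0) (auto elim!: eventually_mono simp: not_less)
  then show ?thesis using pos by simp
next
  case False
  then obtain d where m: "m = ennreal d" and d: "0 < d"
    using pos(5) by (cases m) auto
  define r where "r = c * B / d"
  have r: "0 < r" using pos d by (simp add: r_def)
  have "enn2real (ennreal (c * B) / m) = r"
    using pos d by (simp add: m r_def divide_ennreal)
  moreover have "1 \<le> inverse r * \<bar>z\<bar> powr p" if "r powr (1 / p) < \<bar>z\<bar>" for z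
  proof -
    have "(r powr (1 / p)) powr p \<le> \<bar>z\<bar> powr p"
      using that pos by (intro powr_mono2) auto
    then show ?thesis using r pos by (simp add: powr_powr field_simps)
  qed
  ultimately have "emeasure M {\<omega> \<in> space M. enn2real (ennreal (c * B) / m) powr (1 / p) < \<bar>Z \<omega>\<bar>}
      \<le> emeasure M {\<omega> \<in> space M. 1 \<le> ennreal (inverse r) * ennreal (\<bar>Z \<omega>\<bar> powr p)}"
    using r by (intro emeasure_mono) (auto simp: ennreal_mult[symmetric] ennreal_1[symmetric] simp del: ennreal_1)
  also have "\<dots> \<le> ennreal (inverse r) * (\<integral>\<^sup>+\<omega>. ennreal (\<bar>Z \<omega>\<bar> powr p) * indicator (space M) \<omega> \<partial>M)"
    by (rule order_trans[OF _ nn_integral_Markov_inequality]) auto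
  also have "\<dots> = ennreal (1 / (c * B)) * (m * (\<integral>\<^sup>+\<omega>. ennreal (\<bar>Z \<omega>\<bar> powr p) \<partial>M))"
  proof -
    have "ennreal (inverse r) = ennreal (1 / (c * B)) * m"
      using pos d by (simp add: m r_def ennreal_mult[symmetric])
    then show ?thesis by (simp add: mult.assoc cong: nn_integral_cong)
  qed
  also have "\<dots> \<le> ennreal (1 / (c * B)) * ennreal (K * B)"
    by (intro mult_left_mono bound) simp
  also have "\<dots> = ennreal (K / c)"
    using pos by (simp add: ennreal_mult[symmetric])
  finally show ?thesis
    using pos by (simp add: emeasure_eq_measure)
qed

text \<open>The exceedance probabilities are at most \<open>K / c n\<close> for large \<open>n\<close>, which is summable, and the
  Borel-Cantelli lemma applies.\<close>

lemma (in prob_space) AE_eventually_bounded_of_moments: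
  fixes X :: "nat \<Rightarrow> 'a \<Rightarrow> real" and a b c :: "nat \<Rightarrow> real" and d :: "nat \<Rightarrow> ennreal"
  assumes [measurable]: "\<And>n. X n \<in> borel_measurable M"
    and pos: "\<And>n. 1 \<le> n \<Longrightarrow> 0 < a n" "\<And>n. 1 \<le> n \<Longrightarrow> 0 < b n" "\<And>n. 1 \<le> n \<Longrightarrow> 0 < c n"
      "\<And>n. 1 \<le> n \<Longrightarrow> 0 < d n"
    and K: "0 \<le> K"
    and bound: "\<forall>\<^sub>F n in sequentially. d n * (\<integral>\<^sup>+\<omega>. ennreal (\<bar>X n \<omega>\<bar> powr a n) \<partial>M) \<le> ennreal (K * b n)"
    and sum: "summable (\<lambda>n. 1 / c (Suc n))"
  shows "AE \<omega> in M. \<forall>\<^sub>F n in sequentially.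
    \<bar>X n \<omega>\<bar> \<le> enn2real (ennreal (c n * b n) / d n) powr (1 / a n)"
proof -
  define r where "r n = enn2real (ennreal (c n * b n) / d n) powr (1 / a n)" for n
  define A where "A n = {\<omega> \<in> space M. r n < \<bar>X n \<omega>\<bar>}" for n
  have [measurable]: "A n \<in> events" for n unfolding A_def by measurable
  have "\<forall>\<^sub>F n in sequentially. norm (prob (A n)) \<le> K * (1 / c n)"
    using bound eventually_ge_at_top[of 1]
  proof eventually_elim
    case (elim n)
    then show ?case
      using moment_tail_bound[of "X n" "a n" "b n" "c n" K "d n"] pos[of n] K
      by (simp add: A_def r_def)
  qed
  moreover have "summable (\<lambda>n. K * (1 / c n))"
    using sum by (intro summable_mult) (simp add: summable_Suc_iff[of "\<lambda>n. 1 / c n"])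
  ultimately have "summable (\<lambda>n. prob (A n))"
    by (rule summable_comparison_test_ev)
  then have "AE \<omega> in M. \<forall>\<^sub>F n in sequentially. \<omega> \<in> space M - A n"
    by (intro borel_cantelli_AE1) (auto simp: emeasure_eq_measure)
  then show ?thesis
    by (rule eventually_mono) (auto elim!: eventually_mono simp: A_def r_def)
qed

section \<open>The almost sure growth bound for the random walk\<close>

theorem theorem2p3:
  fixes M :: "'w measure"
    and \<mu> \<nu> :: "real measure"
    and X DX Y S :: "nat \<Rightarrow> 'w \<Rightarrow> real"
    and a b c :: "nat \<Rightarrow> real"
    and d :: "nat \<Rightarrow> ennreal"
    and C :: real
  assumes "prob_space M"
    and "weakly_stable \<mu>" and "nontrivial_measure \<mu>" and "char_exponent \<mu> > 0"
    and "real_distribution \<nu>"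
    and "weak_random_walk M \<mu> \<nu> X"
    \<comment> \<open>the increments \<open>DX 1, DX 2, \<dots>\<close> are i.i.d. with law \<open>\<nu>\<close>; their joint law with \<open>X\<close>
       is arbitrary\<close>
    and "prob_space.indep_vars M (\<lambda>_. borel) DX {1..}"
    and "\<And>i. i \<ge> 1 \<Longrightarrow> distr M borel (DX i) = \<nu>"
    \<comment> \<open>\<open>Y 0\<close> is the generic copy \<open>Y\<close>\<close>
    and "prob_space.indep_vars M (\<lambda>_. borel) Y UNIV"
    and "\<And>i. distr M borel (Y i) = \<mu>"
    and "prob_space.indep_var M
           (Pi\<^sub>M {1..} (\<lambda>_. borel)) (\<lambda>\<omega>. \<lambda>i\<in>{1..}. DX i \<omega>)
           (Pi\<^sub>M UNIV (\<lambda>_. borel)) (\<lambda>\<omega> i. Y i \<omega>)"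
    and S: "\<And>n \<omega>. S n \<omega> = (\<Sum>k=1..n. DX k \<omega> * Y k \<omega>)"
    and "\<And>n. n \<ge> 1 \<Longrightarrow> a n > 0" and "\<And>n. n \<ge> 1 \<Longrightarrow> b n > 0"
    and "mono_on {1..} a" and "a \<longlonglongrightarrow> char_exponent \<mu>"
    and "filterlim b at_top sequentially"
    and "C > 0"
    and "limsup (\<lambda>n. (\<integral>\<^sup>+\<omega>. ennreal (\<bar>S n \<omega>\<bar> powr a n) \<partial>M) / ennreal (b n)) = ennreal C"
    and "\<And>n. n \<ge> 1 \<Longrightarrow> c n > 0" and "summable (\<lambda>n. 1 / c (Suc n))"
    and d: "\<And>n. d n = (\<integral>\<^sup>+\<omega>. ennreal (\<bar>Y 0 \<omega>\<bar> powr a n) \<partial>M)"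
  shows "measure M (\<Union>n\<in>{1..}. \<Inter>k\<in>{n..}.
           {\<omega> \<in> space M. \<bar>X k \<omega>\<bar> \<le> enn2real (ennreal (c k * b k) / d k) powr (1 / a k)}) = 1"
proof -
  note ws = assms(2) and nt = assms(3) and \<nu> = assms(5) and walk = assms(6)
  note DX = assms(7) and DX_law = assms(8) and Y = assms(9) and Y_law = assms(10)
    and DXY = assms(11)
  note a_pos = assms(13) and b_pos = assms(14) and lim = assms(19) and c_pos = assms(20)
    and c_sum = assms(21)
  interpret prob_space M by (rule assms(1))
  have \<mu>: "real_distribution \<mu>" using ws by (simp add: weakly_stable_def)
  have X [measurable]: "X n \<in> borel_measurable M" for n
    using walk by (simp add: weak_random_walk_def)
  have Y_meas [measurable]: "Y n \<in> borel_measurable M" for n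
    using Y by (simp add: indep_vars_def2)
  have DX_meas: "DX n \<in> borel_measurable M" if "1 \<le> n" for n
    using DX that by (simp add: indep_vars_def2)
  have S_meas [measurable]: "S n \<in> borel_measurable M" for n
    unfolding S[abs_def] by (intro borel_measurable_sum borel_measurable_times DX_meas) auto
  have joint: "indep_vars (\<lambda>_. borel) (case_sum DX Y) ({1..} <+> UNIV)"
    by (rule indep_vars_case_sum[OF DX Y]) (use DXY in \<open>simp add: restrict_UNIV\<close>)
  have products: "indep_vars (\<lambda>_. borel) (\<lambda>k \<omega>. DX k \<omega> * Y k \<omega>) {1..}"
    by (rule indep_vars_paired[OF indep_vars_subset[OF joint]]) auto
  have product_law: "distr M borel (\<lambda>\<omega>. DX k \<omega> * Y k \<omega>) = mixture \<mu> \<nu>" if "1 \<le> k" for k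
    using distr_times_indep[of "Y k" "DX k"]
      indep_vars_imp_indep_var[OF joint, of "Inr k" "Inl k"] that
    by (auto simp: DX_law Y_law)
  \<comment> \<open>Both laws have as characteristic function the \<open>n\<close>-th power of that of \<open>mixture \<mu> \<nu>\<close>.\<close>
  have S_law: "distr M borel (S n) = mixture \<mu> (distr M borel (X n))" if "1 \<le> n" for n
  proof (intro Levy_uniqueness real_distribution_mixture real_distribution_distr \<mu> X S_meas ext)
    fix t
    have "char (distr M borel (S n)) t = (\<Prod>k=1..n. char (mixture \<mu> \<nu>) t)"
      unfolding S[abs_def]
      using char_distr_sum[OF indep_vars_subset[OF products], of "{1..n}" t]
      by (simp add: product_law)
    also have "\<dots> = char (mixture \<mu> (distr M borel (X n))) t"
      using that char_mixture_weak_conv_power[OF ws nt \<nu>, of n t]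
      by (simp add: weak_random_walk_law[OF assms(1) ws nt \<nu> walk] char_weak_conv[OF ws nt]
          real_distribution_return char_mixture_return_0[OF \<mu>])
    finally show "char (distr M borel (S n)) t = char (mixture \<mu> (distr M borel (X n))) t" .
  qed
  have d_eq: "d n = abs_moment \<mu> (a n)" for n
    unfolding d Y_law[of 0, symmetric] abs_moment_def by (simp add: nn_integral_distr)
  have moments: "(\<integral>\<^sup>+\<omega>. ennreal (\<bar>S n \<omega>\<bar> powr a n) \<partial>M)
      = d n * (\<integral>\<^sup>+\<omega>. ennreal (\<bar>X n \<omega>\<bar> powr a n) \<partial>M)" if "1 \<le> n" for n
  proof -
    have "(\<integral>\<^sup>+\<omega>. ennreal (\<bar>S n \<omega>\<bar> powr a n) \<partial>M) = abs_moment (distr M borel (S n)) (a n)"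
      by (simp add: abs_moment_def nn_integral_distr)
    also have "\<dots> = abs_moment \<mu> (a n) * abs_moment (distr M borel (X n)) (a n)"
      unfolding S_law[OF that] by (intro abs_moment_mixture \<mu> real_distribution_distr X)
    also have "abs_moment (distr M borel (X n)) (a n) = (\<integral>\<^sup>+\<omega>. ennreal (\<bar>X n \<omega>\<bar> powr a n) \<partial>M)"
      by (simp add: abs_moment_def nn_integral_distr)
    finally show ?thesis by (simp add: d_eq)
  qed
  \<comment> \<open>Any constant above the limit superior serves as a bound for all large \<open>n\<close>.\<close>
  have "ennreal C < ennreal (C + 1)"
    using \<open>C > 0\<close> by (simp add: ennreal_less_iff)
  then have "\<forall>\<^sub>F n in sequentially.
      (\<integral>\<^sup>+\<omega>. ennreal (\<bar>S n \<omega>\<bar> powr a n) \<partial>M) / ennreal (b n) < ennreal (C + 1)"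
    using lim by (intro Limsup_lessD) simp
  then have bound: "\<forall>\<^sub>F n in sequentially.
      d n * (\<integral>\<^sup>+\<omega>. ennreal (\<bar>X n \<omega>\<bar> powr a n) \<partial>M) \<le> ennreal ((C + 1) * b n)"
    using eventually_ge_at_top[of 1]
  proof eventually_elim
    case (elim n)
    have b: "0 < b n" using b_pos elim(2) .
    let ?E = "\<integral>\<^sup>+\<omega>. ennreal (\<bar>S n \<omega>\<bar> powr a n) \<partial>M"
    have "?E = ?E / ennreal (b n) * ennreal (b n)"
      using b by (simp add: ennreal_divide_times ennreal_times_divide[symmetric])
    also have "\<dots> \<le> ennreal (C + 1) * ennreal (b n)"
      using elim(1) by (intro mult_right_mono) auto
    also have "\<dots> = ennreal ((C + 1) * b n)"
      using \<open>C > 0\<close> b by (simp add: ennreal_mult)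
    finally show ?case by (simp add: moments[OF elim(2)])
  qed
  have "AE \<omega> in M. \<forall>\<^sub>F n in sequentially.
      \<bar>X n \<omega>\<bar> \<le> enn2real (ennreal (c n * b n) / d n) powr (1 / a n)"
    using \<open>C > 0\<close>
    by (intro AE_eventually_bounded_of_moments[OF X a_pos b_pos c_pos _ _ bound c_sum])
      (auto simp: d_eq abs_moment_pos[OF \<mu> nt])
  with AE_space have "AE \<omega> in M. \<omega> \<in> (\<Union>n\<in>{1..}. \<Inter>k\<in>{n..}.
      {\<omega> \<in> space M. \<bar>X k \<omega>\<bar> \<le> enn2real (ennreal (c k * b k) / d k) powr (1 / a k)})"
  proof eventually_elim
    case (elim \<omega>)
    then obtain N where "\<forall>k\<ge>N. \<bar>X k \<omega>\<bar> \<le> enn2real (ennreal (c k * b k) / d k) powr (1 / a k)"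
      by (auto simp: eventually_sequentially)
    with elim(1) show ?case
      \<comment> \<open>The union starts at \<open>1\<close>, while \<open>N\<close> may be \<open>0\<close>.\<close>
      by (intro UN_I[of "max 1 N"]) auto
  qed
  then show ?thesis
    by (subst prob_eq_1) measurable
qed

end
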